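(* Let $(V,g)$ be a real inner product space of signature $(2,2)$ and let $A$ be an algebraic curvature tensor on $(V,g)$. The $0$-model $(V,g,A)$ is Osserman if and only if there exist linear operators $\Phi_1,\Phi_2,\Phi_3:V\to V$, skew-adjoint with respect to $g$, with $\Phi_3=\Phi_2\Phi_1$, and real constants $\lambda_0,\lambda_1,\lambda_2,\lambda_3$ and $\lambda_{ij}$ ($1\le i<j\le 3$) such that (i) $\Phi_1^2=-\operatorname{Id}$ and $\Phi_2^2=\Phi_3^2=\operatorname{Id}$; (ii) $\Phi_i\Phi_j+\Phi_j\Phi_i=0$ whenever $i\neq j$; (iii) $A=\lambda_0R_0+\sum_{i=1}^3\lambda_iR_{\Phi_i}+\sum_{1\le i<j\le 3}\lambda_{ij}\left[R_{\Phi_i}+R_{\Phi_j}-R_{(\Phi_i-\Phi_j)}\right]$.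
   Context: Inner products are non-degenerate symmetric bilinear forms; signature $(2,2)$ means $V$ is $4$-dimensional with $2$ negative (timelike) and $2$ positive (spacelike) directions. A vector $x$ is unit timelike if $g(x,x)=-1$. An algebraic curvature tensor $A$ on $(V,g)$ is a $4$-linear form with $A(x,y,z,v)=-A(y,x,z,v)=-A(x,y,v,z)$, $A(x,y,z,v)=A(z,v,x,y)$, and $A(x,y,z,v)+A(y,z,x,v)+A(z,x,y,v)=0$. It is identified with the operator-valued form $A(x,y)z$ via $A(x,y,z,v)=g(A(x,y)z,v)$. The triple $(V,g,A)$ is called a $0$-model. The Jacobi operator $J_A(x):V\to V$ is defined by $g(J_A(x)y,z)=A(y,x,x,z)$, i.e. $J_A(x)y=A(y,x)x$. The $0$-model $(V,g,A)$ is Osserman if the characteristic polynomial of $J_A(x)$ does not depend on the choice of unit timelike vector $x$. The tensor $R_0$ is $R_0(x,y)z=g(x,z)y-g(y,z)x$. For a skew-adjoint linear operator $\Phi$ on $V$ (i.e. $g(\Phi x,y)=-g(x,\Phi y)$), the tensor $R_\Phi$ is $R_\Phi(x,y)z=g(\Phi y,z)\Phi x-g(\Phi x,z)\Phi y-2g(\Phi x,y)\Phi z$. *)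

theory Defs
  imports "HOL-Analysis.Linear_Algebra" "Jordan_Normal_Form.Char_Poly"
begin

definition inner_product :: "('v::real_vector \<Rightarrow> 'v \<Rightarrow> real) \<Rightarrow> bool" where
  "inner_product g \<longleftrightarrow>
     bilinear g \<and> (\<forall>x y. g x y = g y x) \<and> (\<forall>x. (\<forall>y. g x y = 0) \<longrightarrow> x = 0)"

text \<open>
  The first number counts the negative (timelike) directions, the second one the positive
  (spacelike) directions. Together with non-degeneracy this forces the dimension of the
  space to be \<open>p + q\<close>, see \<open>signature_dim\<close> below.
\<close>

definition has_signature :: "('v::real_vector \<Rightarrow> 'v \<Rightarrow> real) \<Rightarrow> nat \<Rightarrow> nat \<Rightarrow> bool" where
  "has_signature g p q \<longleftrightarrow>
     (\<exists>B. finite B \<and> independent B \<and> span B = UNIV \<and> pairwise (\<lambda>x y. g x y = 0) B \<and>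
          card {b \<in> B. g b b < 0} = p \<and> card {b \<in> B. g b b > 0} = q)"

definition four_linear :: "('v::real_vector \<Rightarrow> 'v \<Rightarrow> 'v \<Rightarrow> 'v \<Rightarrow> real) \<Rightarrow> bool" where
  "four_linear A \<longleftrightarrow>
     (\<forall>y z v. linear (\<lambda>x. A x y z v)) \<and> (\<forall>x z v. linear (\<lambda>y. A x y z v)) \<and>
     (\<forall>x y v. linear (\<lambda>z. A x y z v)) \<and> (\<forall>x y z. linear (\<lambda>v. A x y z v))"

definition algebraic_curvature_tensor ::
  "('v::real_vector \<Rightarrow> 'v \<Rightarrow> 'v \<Rightarrow> 'v \<Rightarrow> real) \<Rightarrow> bool" where
  "algebraic_curvature_tensor A \<longleftrightarrow> four_linear A \<and>
     (\<forall>x y z v. A x y z v = - A y x z v \<and> A x y z v = - A x y v z \<and> A x y z v = A z v x y \<and>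
        A x y z v + A y z x v + A z x y v = 0)"

text \<open>
  \<open>curv_op\<close> and \<open>curv_form\<close> are the two directions of the identification of a \<open>4\<close>-linear form
  with an operator-valued bilinear form, \<open>A(x,y,z,v) = g(A(x,y)z,v)\<close>. See \<open>g_curv_op\<close> below
  for the existence of the vector described by \<open>THE\<close>.
\<close>

definition curv_op ::
  "('v \<Rightarrow> 'v \<Rightarrow> real) \<Rightarrow> ('v \<Rightarrow> 'v \<Rightarrow> 'v \<Rightarrow> 'v \<Rightarrow> real) \<Rightarrow> 'v::real_vector \<Rightarrow> 'v \<Rightarrow> 'v \<Rightarrow> 'v" where
  "curv_op g A x y z = (THE w. \<forall>v. g w v = A x y z v)"

definition curv_form ::
  "('v \<Rightarrow> 'v \<Rightarrow> real) \<Rightarrow> ('v \<Rightarrow> 'v \<Rightarrow> 'v \<Rightarrow> 'v) \<Rightarrow> 'v::real_vector \<Rightarrow> 'v \<Rightarrow> 'v \<Rightarrow> 'v \<Rightarrow> real" where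
  "curv_form g R x y z v = g (R x y z) v"

definition jacobi_op ::
  "('v \<Rightarrow> 'v \<Rightarrow> real) \<Rightarrow> ('v \<Rightarrow> 'v \<Rightarrow> 'v \<Rightarrow> 'v \<Rightarrow> real) \<Rightarrow> 'v::real_vector \<Rightarrow> 'v \<Rightarrow> 'v" where
  "jacobi_op g A x y = curv_op g A y x x"

definition basis_list :: "'v::real_vector list \<Rightarrow> bool" where
  "basis_list bs \<longleftrightarrow> distinct bs \<and> independent (set bs) \<and> span (set bs) = UNIV"

text \<open>The matrix of \<open>f\<close> with respect to the ordered bases \<open>cs\<close> (domain) and \<open>bs\<close> (codomain).\<close>

definition op_matrix ::
  "'v::real_vector list \<Rightarrow> 'v list \<Rightarrow> ('v \<Rightarrow> 'v) \<Rightarrow> real mat" where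
  "op_matrix bs cs f =
     mat (length bs) (length cs) (\<lambda>(i, j). representation (set bs) (f (cs ! j)) (bs ! i))"

text \<open>
  Only meaningful on a finite-dimensional space; the choice of the basis is immaterial there
  by \<open>op_char_poly_eq\<close> below.
\<close>

definition op_char_poly :: "('v::real_vector \<Rightarrow> 'v) \<Rightarrow> real poly" where
  "op_char_poly f = (let bs = (SOME bs. basis_list bs) in char_poly (op_matrix bs bs f))"

definition osserman ::
  "('v::real_vector \<Rightarrow> 'v \<Rightarrow> real) \<Rightarrow> ('v \<Rightarrow> 'v \<Rightarrow> 'v \<Rightarrow> 'v \<Rightarrow> real) \<Rightarrow> bool" where
  "osserman g A \<longleftrightarrow>
     (\<forall>x y. g x x = -1 \<and> g y y = -1 \<longrightarrow>
        op_char_poly (jacobi_op g A x) = op_char_poly (jacobi_op g A y))"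

definition skew_adjoint :: "('v::real_vector \<Rightarrow> 'v \<Rightarrow> real) \<Rightarrow> ('v \<Rightarrow> 'v) \<Rightarrow> bool" where
  "skew_adjoint g \<Phi> \<longleftrightarrow> (\<forall>x y. g (\<Phi> x) y = - g x (\<Phi> y))"

definition R0_op :: "('v \<Rightarrow> 'v \<Rightarrow> real) \<Rightarrow> 'v::real_vector \<Rightarrow> 'v \<Rightarrow> 'v \<Rightarrow> 'v" where
  "R0_op g x y z = g x z *\<^sub>R y - g y z *\<^sub>R x"

definition RPhi_op ::
  "('v \<Rightarrow> 'v \<Rightarrow> real) \<Rightarrow> ('v \<Rightarrow> 'v) \<Rightarrow> 'v::real_vector \<Rightarrow> 'v \<Rightarrow> 'v \<Rightarrow> 'v" where
  "RPhi_op g \<Phi> x y z =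
     g (\<Phi> y) z *\<^sub>R \<Phi> x - g (\<Phi> x) z *\<^sub>R \<Phi> y - (2 * g (\<Phi> x) y) *\<^sub>R \<Phi> z"

abbreviation R0 :: "('v \<Rightarrow> 'v \<Rightarrow> real) \<Rightarrow> 'v::real_vector \<Rightarrow> 'v \<Rightarrow> 'v \<Rightarrow> 'v \<Rightarrow> real" where
  "R0 g \<equiv> curv_form g (R0_op g)"

abbreviation RPhi ::
  "('v \<Rightarrow> 'v \<Rightarrow> real) \<Rightarrow> ('v \<Rightarrow> 'v) \<Rightarrow> 'v::real_vector \<Rightarrow> 'v \<Rightarrow> 'v \<Rightarrow> 'v \<Rightarrow> real" where
  "RPhi g \<Phi> \<equiv> curv_form g (RPhi_op g \<Phi>)"


subsection \<open>Well-definedness\<close>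

lemma inner_product_orthogonal_basis_nonzero:
  assumes g: "inner_product g" and B: "span B = UNIV" "pairwise (\<lambda>x y. g x y = 0) B"
    and ind: "independent B" and b: "b \<in> B"
  shows "g b b \<noteq> 0"
proof
  assume 0: "g b b = 0"
  have lin: "linear (g b)" using g by (simp add: inner_product_def bilinear_def)
  have on_B: "g b c = 0" if "c \<in> B" for c
    using that 0 B(2) b by (cases "c = b") (auto simp: pairwise_def)
  have "g b y = 0" for y
    using linear_eq_0_on_span[OF lin, of B y] on_B B(1) by auto
  hence "b = 0" using g by (auto simp: inner_product_def)
  thus False using ind b dependent_zero by blast
qed

lemma signature_dim:
  fixes g :: "'v::real_vector \<Rightarrow> 'v \<Rightarrow> real"
  assumes g: "inner_product g" and s: "has_signature g p q"
  shows "dim (UNIV :: 'v set) = p + q"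
proof -
  obtain B where B: "finite B" "independent B" "span B = UNIV" "pairwise (\<lambda>x y. g x y = 0) B"
    "card {b \<in> B. g b b < 0} = p" "card {b \<in> B. g b b > 0} = q"
    using s by (auto simp: has_signature_def)
  have "B = {b \<in> B. g b b < 0} \<union> {b \<in> B. g b b > 0}"
    using inner_product_orthogonal_basis_nonzero[OF g B(3,4,2)] by force
  hence "card B = card ({b \<in> B. g b b < 0} \<union> {b \<in> B. g b b > 0})" by simp
  also have "\<dots> = p + q"
    using B(1,5,6) by (subst card_Un_disjoint) auto
  finally show ?thesis
    using dim_span_eq_card_independent[OF B(2)] B(3) by simp
qed

lemma inner_product_riesz:
  assumes g: "inner_product g" and s: "has_signature g p q" and f: "linear f"
  shows "\<exists>!w. \<forall>v. g w v = f v"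
proof -
  obtain B where B: "finite B" "independent B" "span B = UNIV" "pairwise (\<lambda>x y. g x y = 0) B"
    using s by (auto simp: has_signature_def)
  have lin: "linear (g x)" "linear (\<lambda>x. g x y)" for x y
    using g by (simp_all add: inner_product_def bilinear_def)
  define w where "w = (\<Sum>b\<in>B. (f b / g b b) *\<^sub>R b)"
  have on_B: "g w c = f c" if c: "c \<in> B" for c
  proof -
    have "g w c = (\<Sum>b\<in>B. f b / g b b * g b c)"
      by (simp add: w_def linear_sum[OF lin(2)] linear_scale[OF lin(2)])
    also have "\<dots> = (\<Sum>b\<in>B. if b = c then f c else 0)"
      using inner_product_orthogonal_basis_nonzero[OF g B(3,4,2)] B(4) c
      by (intro sum.cong) (auto simp: pairwise_def)
    finally show ?thesis using B(1) c by simp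
  qed
  have w: "\<forall>v. g w v = f v"
    using linear_eq_on_span[OF lin(1) f on_B] B(3) by auto
  moreover have "w' = w" if "\<forall>v. g w' v = f v" for w'
  proof -
    have "g (w' - w) v = 0" for v
      using that w by (simp add: linear_diff[OF lin(2)])
    hence "w' - w = 0" using g unfolding inner_product_def by blast
    thus ?thesis by simp
  qed
  ultimately show ?thesis by blast
qed

lemma g_curv_op:
  assumes "inner_product g" "has_signature g p q" "four_linear A"
  shows "g (curv_op g A x y z) v = A x y z v"
proof -
  have "\<exists>!w. \<forall>v. g w v = A x y z v"
    using assms(3) by (intro inner_product_riesz[OF assms(1,2)]) (simp add: four_linear_def)
  from theI'[OF this] show ?thesis unfolding curv_op_def by blast
qed

lemma g_jacobi_op:
  assumes "inner_product g" "has_signature g p q" "four_linear A"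
  shows "g (jacobi_op g A x y) z = A y x x z"
  unfolding jacobi_op_def by (rule g_curv_op[OF assms])

lemma op_matrix_mult:
  assumes bs: "basis_list bs" and cs: "basis_list cs" and f: "linear f"
  shows "op_matrix bs cs f * op_matrix cs ds h = op_matrix bs ds (f \<circ> h)"
proof (rule eq_matI)
  fix i j assume "i < dim_row (op_matrix bs ds (f \<circ> h))" "j < dim_col (op_matrix bs ds (f \<circ> h))"
  hence ij: "i < length bs" "j < length ds" by (simp_all add: op_matrix_def)
  let ?r = "representation (set bs)" and ?s = "representation (set cs)"
  let ?v = "h (ds ! j)"
  have ib: "independent (set bs)" "span (set bs) = UNIV" and
    ic: "independent (set cs)" "span (set cs) = UNIV" and dc: "distinct cs"
    using bs cs by (auto simp: basis_list_def)
  have "?v = (\<Sum>c\<in>set cs. ?s ?v c *\<^sub>R c)"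
    using real_vector.sum_representation_eq[OF ic(1), of ?v "set cs"] ic(2) by simp
  hence "f ?v = (\<Sum>c\<in>set cs. ?s ?v c *\<^sub>R f c)"
    by (metis (no_types, lifting) linear_sum[OF f] linear_scale[OF f] sum.cong)
  hence "?r (f ?v) (bs ! i) = (\<Sum>c\<in>set cs. ?s ?v c * ?r (f c) (bs ! i))"
    by (simp add: real_vector.representation_sum[OF ib(1)] real_vector.representation_scale[OF ib(1)]
        ib(2))
  also have "\<dots> = (\<Sum>k<length cs. ?s ?v (cs ! k) * ?r (f (cs ! k)) (bs ! i))"
    by (rule sum.reindex_bij_betw[symmetric]) (use bij_betw_nth[OF dc] in auto)
  finally show "(op_matrix bs cs f * op_matrix cs ds h) $$ (i, j) = op_matrix bs ds (f \<circ> h) $$ (i, j)"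
    using ij by (simp add: op_matrix_def scalar_prod_def atLeast0LessThan mult.commute)
qed (simp_all add: op_matrix_def)

lemma op_matrix_id:
  assumes bs: "basis_list bs"
  shows "op_matrix bs bs id = 1\<^sub>m (length bs)"
  using assms
  by (intro eq_matI)
     (auto simp: op_matrix_def basis_list_def real_vector.representation_basis nth_eq_iff_index_eq)

lemma op_char_poly_eq:
  fixes f :: "'v::real_vector \<Rightarrow> 'v"
  assumes bs: "basis_list bs" and f: "linear f"
  shows "op_char_poly f = char_poly (op_matrix bs bs f)"
proof -
  define cs :: "'v list" where "cs = (SOME cs. basis_list cs)"
  have cs: "basis_list cs" unfolding cs_def by (rule someI[of basis_list, OF bs])
  have *: "dim (UNIV :: 'v set) = length xs" if "basis_list xs" for xs :: "'v list"
    using that dim_span_eq_card_independent[of "set xs"] by (simp add: basis_list_def distinct_card)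
  have len: "length cs = length bs" using *[OF bs] *[OF cs] by simp
  have id: "linear (id :: 'v \<Rightarrow> 'v)" by (rule linear_id)
  let ?P = "op_matrix cs bs id" and ?Q = "op_matrix bs cs id"
  have PQ: "?P * ?Q = 1\<^sub>m (length bs)" "?Q * ?P = 1\<^sub>m (length bs)"
    by (simp_all only: op_matrix_mult[OF cs bs id] op_matrix_mult[OF bs cs id] o_id
        op_matrix_id[OF cs] op_matrix_id[OF bs] len)
  have eq: "op_matrix cs cs f = ?P * op_matrix bs bs f * ?Q"
    by (simp only: op_matrix_mult[OF cs bs id] op_matrix_mult[OF cs bs f] o_id id_o)
  have carrier: "op_matrix xs ys h \<in> carrier_mat (length xs) (length ys)"
    for xs ys :: "'v list" and h
    by (simp add: op_matrix_def)
  have dr: "dim_row (op_matrix cs cs f) = length bs" by (simp add: op_matrix_def len)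
  have "similar_mat_wit (op_matrix cs cs f) (op_matrix bs bs f) ?P ?Q"
    unfolding similar_mat_wit_def Let_def dr
    using PQ eq carrier[of cs cs f] carrier[of bs bs f] carrier[of cs bs id] carrier[of bs cs id] len
    by (intro conjI) simp_all
  hence "similar_mat (op_matrix cs cs f) (op_matrix bs bs f)"
    unfolding similar_mat_def by blast
  hence "char_poly (op_matrix cs cs f) = char_poly (op_matrix bs bs f)"
    by (rule char_poly_similar)
  thus ?thesis by (simp add: op_char_poly_def cs_def Let_def)
qed

end

theory Submission
  imports Defs
begin

text \<open>
  If \<open>A\<close> has the stated form and \<open>x\<close> is unit timelike, then \<open>x, \<Phi>\<^sub>1 x, \<Phi>\<^sub>2 x, \<Phi>\<^sub>3 x\<close> is a
  pseudo-orthonormal basis in which the matrix of the Jacobi operator depends only on the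
  constants.

  Conversely, let \<open>a, b, c, d\<close> be a null frame, \<open>g a d = -1\<close>, \<open>g b c = 1\<close>. The timelike vectors
  \<open>a + (t / 2) d\<close> tend to \<open>a\<close> as \<open>t\<close> decreases to \<open>0\<close>, so the Osserman condition and homogeneity force the
  characteristic polynomial of the Jacobi operator of \<open>a\<close> to be \<open>X\<^sup>4\<close>. This says
  \<open>A a b a c = 0\<close> and \<open>A a b a b * A a c a c = 0\<close>. A null frame identifies \<open>V\<close> with a tensor
  product of two planes \<open>U \<otimes> U'\<close>, and unimodular changes of basis in the planes turn it into
  other null frames. Hence \<open>p u * q v = 0\<close> for all \<open>u\<close> in \<open>U\<close> and \<open>v\<close> in \<open>U'\<close>, where the
  quartics \<open>p\<close> and \<open>q\<close> are the self-dual and the anti-self-dual part of the Weyl tensor, so one of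
  them vanishes. The equations \<open>A a b a c = 0\<close> in all frames say that \<open>A\<close> is Einstein. Only six
  parameters of \<open>A\<close> remain, and they are matched by the \<open>\<lambda>\<^sub>i\<close> and \<open>\<lambda>\<^sub>i\<^sub>j\<close> for the
  para-quaternionic structure acting on the first tensor factor; \<open>\<lambda>\<^sub>0\<close> is redundant.
\<close>

section \<open>Bases and determinants\<close>

text \<open>Dual functionals read off the coefficients of any linear combination, which gives
  independence; a list of length \<open>dim UNIV\<close> must then span. The bases used below have
  duals built from \<open>g\<close>, so matrices of operators can be computed entrywise.\<close>

lemma basis_list_dual:
  fixes bs :: "'v::real_vector list" and f :: "nat \<Rightarrow> 'v \<Rightarrow> real"
  assumes lin: "\<And>i. linear (f i)"
    and dual: "\<And>i j. i < length bs \<Longrightarrow> j < length bs \<Longrightarrow> f i (bs ! j) = (if i = j then 1 else 0)"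
    and len: "length bs = dim (UNIV :: 'v set)" and pos: "0 < dim (UNIV :: 'v set)"
  shows "basis_list bs" and "i < length bs \<Longrightarrow> representation (set bs) w (bs ! i) = f i w"
proof -
  have dist: "distinct bs"
    unfolding distinct_conv_nth by (metis dual zero_neq_one)
  have coef: "f i (\<Sum>v\<in>set bs. u v *\<^sub>R v) = u (bs ! i)" if i: "i < length bs" for i u
  proof -
    have "f i (\<Sum>v\<in>set bs. u v *\<^sub>R v) = (\<Sum>v\<in>set bs. u v * f i v)"
      by (simp add: linear_sum[OF lin] linear_scale[OF lin])
    also have "\<dots> = (\<Sum>k<length bs. u (bs ! k) * f i (bs ! k))"
      by (rule sum.reindex_bij_betw[symmetric]) (use bij_betw_nth[OF dist] in auto)
    also have "\<dots> = (\<Sum>k<length bs. if i = k then u (bs ! k) else 0)"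
      using i by (intro sum.cong) (auto simp: dual)
    finally show ?thesis using i by simp
  qed
  have ind: "independent (set bs)"
  proof (rule real_vector.independent_if_scalars_zero)
    fix u v assume "(\<Sum>x\<in>set bs. u x *\<^sub>R x) = 0" and v: "v \<in> set bs"
    then show "u v = 0"
      using coef[of _ u] linear_0[OF lin] by (metis in_set_conv_nth)
  qed simp
  obtain B :: "'v set" where B: "independent B" "UNIV \<subseteq> span B" "card B = dim (UNIV :: 'v set)"
    using real_vector.basis_exists[of UNIV] by blast
  \<comment> \<open>An infinite set has \<open>card\<close> 0, which \<open>pos\<close>
    excludes.\<close>
  have finB: "finite B" by (rule card_ge_0_finite) (use B(3) pos in simp)
  have spn: "span (set bs) = UNIV"
  proof (rule ccontr)
    assume "span (set bs) \<noteq> UNIV"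
    then obtain x where x: "x \<notin> span (set bs)" by blast
    then have "independent (insert x (set bs))" using ind by (rule real_vector.independent_insertI)
    then have "card (insert x (set bs)) \<le> card B"
      using real_vector.independent_span_bound[OF finB] B(2) by blast
    moreover have "x \<notin> set bs" using x real_vector.span_base by blast
    ultimately show False using dist len B(3) by (simp add: distinct_card)
  qed
  show bl: "basis_list bs" using dist ind spn by (simp add: basis_list_def)
  show "representation (set bs) w (bs ! i) = f i w" if "i < length bs"
    using coef[OF that, of "representation (set bs) w"]
      real_vector.sum_representation_eq[OF ind, of w "set bs"] spn by simp
qed

lemma det_4:
  fixes M :: "'a::comm_ring_1 mat"
  assumes "M \<in> carrier_mat 4 4"
  shows "det M =
    M $$ (0,0) * (M $$ (1,1) * (M $$ (2,2) * M $$ (3,3) - M $$ (2,3) * M $$ (3,2))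
                - M $$ (1,2) * (M $$ (2,1) * M $$ (3,3) - M $$ (2,3) * M $$ (3,1))
                + M $$ (1,3) * (M $$ (2,1) * M $$ (3,2) - M $$ (2,2) * M $$ (3,1)))
  - M $$ (0,1) * (M $$ (1,0) * (M $$ (2,2) * M $$ (3,3) - M $$ (2,3) * M $$ (3,2))
                - M $$ (1,2) * (M $$ (2,0) * M $$ (3,3) - M $$ (2,3) * M $$ (3,0))
                + M $$ (1,3) * (M $$ (2,0) * M $$ (3,2) - M $$ (2,2) * M $$ (3,0)))
  + M $$ (0,2) * (M $$ (1,0) * (M $$ (2,1) * M $$ (3,3) - M $$ (2,3) * M $$ (3,1))
                - M $$ (1,1) * (M $$ (2,0) * M $$ (3,3) - M $$ (2,3) * M $$ (3,0))
                + M $$ (1,3) * (M $$ (2,0) * M $$ (3,1) - M $$ (2,1) * M $$ (3,0)))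
  - M $$ (0,3) * (M $$ (1,0) * (M $$ (2,1) * M $$ (3,2) - M $$ (2,2) * M $$ (3,1))
                - M $$ (1,1) * (M $$ (2,0) * M $$ (3,2) - M $$ (2,2) * M $$ (3,0))
                + M $$ (1,2) * (M $$ (2,0) * M $$ (3,1) - M $$ (2,1) * M $$ (3,0)))"
proof -
  have d2: "det N = N $$ (0,0) * N $$ (1,1) - N $$ (0,1) * N $$ (1,0)"
    if "N \<in> carrier_mat 2 2" for N :: "'a mat"
    using laplace_expansion_row[OF that, of 0] that
    by (simp add: numeral_2_eq_2 cofactor_def det_single mat_delete_def)
  have d3: "det N = N $$ (0,0) * (N $$ (1,1) * N $$ (2,2) - N $$ (1,2) * N $$ (2,1))
     - N $$ (0,1) * (N $$ (1,0) * N $$ (2,2) - N $$ (1,2) * N $$ (2,0))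
     + N $$ (0,2) * (N $$ (1,0) * N $$ (2,1) - N $$ (1,1) * N $$ (2,0))"
    if "N \<in> carrier_mat 3 3" for N :: "'a mat"
    using laplace_expansion_row[OF that, of 0] that
    by (simp add: numeral_3_eq_3 numeral_2_eq_2 cofactor_def d2 mat_delete_def right_diff_distrib)
  show ?thesis
    using laplace_expansion_row[OF assms, of 0] assms
    by (simp add: eval_nat_numeral cofactor_def d3 mat_delete_def algebra_simps)
qed

text \<open>By the Leibniz formula the determinant is a polynomial in the entries.\<close>

lemma tendsto_det:
  fixes M :: "'b \<Rightarrow> real mat"
  assumes "\<And>x. M x \<in> carrier_mat n n" "L \<in> carrier_mat n n"
    and lim: "\<And>i j. i < n \<Longrightarrow> j < n \<Longrightarrow> ((\<lambda>x. M x $$ (i, j)) \<longlongrightarrow> L $$ (i, j)) F"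
  shows "((\<lambda>x. det (M x)) \<longlongrightarrow> det L) F"
proof -
  have M: "dim_row (M x) = n" "dim_col (M x) = n" and L: "dim_row L = n" "dim_col L = n" for x
    using assms(1)[of x] assms(2) by auto
  show ?thesis
    unfolding det_def M L if_True simp_thms
    by (intro tendsto_sum tendsto_mult tendsto_const tendsto_prod lim)
      (auto simp: permutes_in_image)
qed

section \<open>Null frames and the limit of the Jacobi operators\<close>

text \<open>In the tensor picture \<open>g\<close> is minus the product of the area forms of the two
  planes (see \<open>g_tens\<close>), hence the opposite signs of \<open>g a d\<close> and
  \<open>g b c\<close>.\<close>

definition null_frame :: "('v::real_vector \<Rightarrow> 'v \<Rightarrow> real) \<Rightarrow> 'v \<Rightarrow> 'v \<Rightarrow> 'v \<Rightarrow> 'v \<Rightarrow> bool" where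
  "null_frame g a b c d \<longleftrightarrow> g a d = -1 \<and> g b c = 1 \<and> g a a = 0 \<and> g b b = 0 \<and> g c c = 0 \<and> g d d = 0 \<and>
     g a b = 0 \<and> g a c = 0 \<and> g b d = 0 \<and> g c d = 0"

locale signature22 =
  fixes g :: "'v::real_vector \<Rightarrow> 'v \<Rightarrow> real"
  assumes inner_product: "inner_product g" and signature: "has_signature g 2 2"
begin

lemma dim_UNIV: "dim (UNIV :: 'v set) = 4"
  using signature_dim[OF inner_product signature] by simp

lemma g_commute: "g x y = g y x"
  using inner_product by (simp add: inner_product_def)

lemma linear_g: "linear (g x)" "linear (\<lambda>x. g x y)"
  using inner_product by (simp_all add: inner_product_def bilinear_def)

lemmas g_simps [simp] =
  linear_add[OF linear_g(1)] linear_add[OF linear_g(2)]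
  linear_diff[OF linear_g(1)] linear_diff[OF linear_g(2)]
  linear_neg[OF linear_g(1)] linear_neg[OF linear_g(2)]
  linear_scale[OF linear_g(1)] linear_scale[OF linear_g(2)]
  linear_0[OF linear_g(1)] linear_0[OF linear_g(2)]

lemma g_ext: "(\<And>z. g x z = g y z) \<Longrightarrow> x = y"
  using inner_product unfolding inner_product_def
  by (metis eq_iff_diff_eq_0 g_simps(4))

lemma null_frame_values:
  assumes "null_frame g a b c d"
  shows "g a d = -1" "g d a = -1" "g b c = 1" "g c b = 1" "g a a = 0" "g b b = 0" "g c c = 0" "g d d = 0"
    "g a b = 0" "g b a = 0" "g a c = 0" "g c a = 0" "g b d = 0" "g d b = 0" "g c d = 0" "g d c = 0"
  using assms by (simp_all add: null_frame_def g_commute)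

lemma null_frame_basis:
  assumes "null_frame g a b c d"
  shows "basis_list [a, b, c, d]"
    and "i < 4 \<Longrightarrow> representation (set [a, b, c, d]) w ([a, b, c, d] ! i) = [- g w d, g w c, g w b, - g w a] ! i"
proof -
  note fr = null_frame_values[OF assms]
  \<comment> \<open>The \<open>g\<close>-dual of the frame is \<open>- d, c, b, - a\<close>. The
    default 0 makes \<open>f i\<close> linear for every index, as \<open>basis_list_dual\<close>
    demands.\<close>
  define f where "f i w = (if i < 4 then [- g w d, g w c, g w b, - g w a] ! i else 0)" for i :: nat and w
  have "linear (f i)" for i
    by (cases "i < 4") (auto simp: f_def eval_nat_numeral less_Suc_eq intro!: linearI)
  moreover have "f i ([a, b, c, d] ! j) = (if i = j then 1 else 0)"
    if "i < length [a, b, c, d]" "j < length [a, b, c, d]" for i j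
    using that by (auto simp: f_def eval_nat_numeral less_Suc_eq fr)
  moreover have "length [a, b, c, d] = dim (UNIV :: 'v set)" "0 < dim (UNIV :: 'v set)"
    by (simp_all add: dim_UNIV)
  ultimately have *: "basis_list [a, b, c, d]"
    "i < length [a, b, c, d] \<Longrightarrow> representation (set [a, b, c, d]) w ([a, b, c, d] ! i) = f i w" for i w
    using basis_list_dual[of f "[a, b, c, d]"] by blast+
  show "basis_list [a, b, c, d]" by (rule *)
  show "i < 4 \<Longrightarrow> representation (set [a, b, c, d]) w ([a, b, c, d] ! i) = [- g w d, g w c, g w b, - g w a] ! i"
    using *(2)[of i w] by (simp add: f_def)
qed

lemma null_frame_exists: "\<exists>a b c d. null_frame g a b c d"
proof -
  obtain B where B: "pairwise (\<lambda>x y. g x y = 0) B"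
    "card {b \<in> B. g b b < 0} = 2" "card {b \<in> B. g b b > 0} = 2"
    using signature by (auto simp: has_signature_def)
  obtain p q where pq: "{b \<in> B. g b b < 0} = {p, q}" "p \<noteq> q"
    using B(2) by (auto simp: card_2_iff)
  obtain r s where rs: "{b \<in> B. g b b > 0} = {r, s}" "r \<noteq> s"
    using B(3) by (auto simp: card_2_iff)
  have mem: "p \<in> B" "q \<in> B" "r \<in> B" "s \<in> B" and sgn: "g p p < 0" "g q q < 0" "g r r > 0" "g s s > 0"
    using pq rs by blast+
  have orth: "g x y = 0" if "x \<in> B" "y \<in> B" "x \<noteq> y" for x y
    using B(1) that by (auto simp: pairwise_def)
  have ne: "p \<noteq> r" "p \<noteq> s" "q \<noteq> r" "q \<noteq> s" using sgn by auto
  define n where "n x = (1 / sqrt \<bar>g x x\<bar>) *\<^sub>R x" for x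
  have unit: "g (n p) (n p) = -1" "g (n q) (n q) = -1" "g (n r) (n r) = 1" "g (n s) (n s) = 1"
    using sgn by (simp_all add: n_def)
  have o: "g (n x) (n y) = 0" if "x \<in> B" "y \<in> B" "x \<noteq> y" for x y
    using orth[OF that] by (simp add: n_def)
  note os = o[OF mem(1,2) pq(2)] o[OF mem(1,3) ne(1)] o[OF mem(1,4) ne(2)]
    o[OF mem(2,3) ne(3)] o[OF mem(2,4) ne(4)] o[OF mem(3,4) rs(2)]
  \<comment> \<open>A timelike and a spacelike unit vector that are orthogonal have null sum and
    difference; the factors 1/2 normalise the products.\<close>
  have "null_frame g ((1/2) *\<^sub>R (n p + n r)) (n q + n s) ((1/2) *\<^sub>R (n s - n q)) (n p - n r)"
    using unit os by (simp add: null_frame_def g_commute field_simps)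
  then show ?thesis by blast
qed

end

locale curvature22 = signature22 g for g :: "'v::real_vector \<Rightarrow> 'v \<Rightarrow> real" +
  fixes A :: "'v \<Rightarrow> 'v \<Rightarrow> 'v \<Rightarrow> 'v \<Rightarrow> real"
  assumes curvature: "algebraic_curvature_tensor A"
begin

lemma four_linear: "four_linear A"
  using curvature by (simp add: algebraic_curvature_tensor_def)

lemma linear_A: "linear (\<lambda>x. A x y z v)" "linear (\<lambda>y. A x y z v)"
    "linear (\<lambda>z. A x y z v)" "linear (\<lambda>v. A x y z v)"
  using four_linear by (simp_all add: four_linear_def)

lemmas A_simps [simp] =
  linear_add[OF linear_A(1)] linear_add[OF linear_A(2)] linear_add[OF linear_A(3)] linear_add[OF linear_A(4)]
  linear_diff[OF linear_A(1)] linear_diff[OF linear_A(2)] linear_diff[OF linear_A(3)] linear_diff[OF linear_A(4)]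
  linear_neg[OF linear_A(1)] linear_neg[OF linear_A(2)] linear_neg[OF linear_A(3)] linear_neg[OF linear_A(4)]
  linear_scale[OF linear_A(1)] linear_scale[OF linear_A(2)] linear_scale[OF linear_A(3)] linear_scale[OF linear_A(4)]

lemma A_skew: "A x y z v = - A y x z v" "A x y z v = - A x y v z"
  and A_pair: "A x y z v = A z v x y"
  and A_bianchi: "A x y z v + A y z x v + A z x y v = 0"
  using curvature unfolding algebraic_curvature_tensor_def by blast+

lemma A_diag [simp]: "A x x z v = 0" "A x y z z = 0"
  using A_skew(1)[of x x z v] A_skew(2)[of x y z z] by simp_all

lemma g_jacobi [simp]: "g (jacobi_op g A x y) z = A y x x z"
  by (rule g_jacobi_op[OF inner_product signature four_linear])

lemma linear_jacobi: "linear (jacobi_op g A x)"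
  by (rule linearI; rule g_ext; simp)

lemma osserman_null_frame:
  assumes oss: "osserman g A" and fr: "null_frame g a b c d"
  shows "A a b a c = 0" and "A a b a b * A a c a c = 0"
proof -
  note frs = null_frame_values[OF fr]
  define bs where "bs = [a, b, c, d]"
  have bs: "basis_list bs" "length bs = 4"
    using null_frame_basis(1)[OF fr] by (simp_all add: bs_def)
  \<comment> \<open>Since \<open>g (x t) (x t) = - t\<close>, for \<open>t > 0\<close> the vector
    \<open>u t\<close> is unit timelike and its Jacobi operator is that of \<open>x t\<close>
    divided by \<open>t\<close>. \<open>N t\<close> is the matrix of the Jacobi operator of
    \<open>x t\<close>, its rows read off by the dual functionals, and \<open>M s t\<close> is
    \<open>s\<close> times the identity minus \<open>N t\<close>.\<close>
  define x where "x t = a + (t / 2) *\<^sub>R d" for t :: real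
  define N where "N t = mat 4 4 (\<lambda>(i, j). let \<phi> = (\<lambda>z. A (bs ! j) (x t) (x t) z) in
      [- \<phi> d, \<phi> c, \<phi> b, - \<phi> a] ! i)" for t :: real
  define M where "M s t = mat 4 4 (\<lambda>(i, j). (if i = j then s else 0) - N t $$ (i, j))" for s t :: real
  define u where "u t = (1 / sqrt t) *\<^sub>R x t" for t :: real
  define P where "P = op_char_poly (jacobi_op g A (u 1))"
  have u: "g (u t) (u t) = -1" if "t > 0" for t
    using that by (simp add: u_def x_def frs)
  have mat: "op_matrix bs bs (jacobi_op g A (u t)) = (1 / t) \<cdot>\<^sub>m N t" if "t > 0" for t
  proof (rule eq_matI; (simp add: op_matrix_def bs N_def; fail)?)
    fix i j assume "i < dim_row ((1 / t) \<cdot>\<^sub>m N t)" "j < dim_col ((1 / t) \<cdot>\<^sub>m N t)"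
    then have ij: "i < 4" "j < 4" by (simp_all add: N_def)
    have ut: "A y (u t) (u t) z = (1 / t) * A y (x t) (x t) z" for y z
      using that by (simp add: u_def)
    have "op_matrix bs bs (jacobi_op g A (u t)) $$ (i, j) =
        representation (set bs) (jacobi_op g A (u t) (bs ! j)) (bs ! i)"
      using ij by (simp add: op_matrix_def bs)
    also have "\<dots> = [- A (bs ! j) (u t) (u t) d, A (bs ! j) (u t) (u t) c,
        A (bs ! j) (u t) (u t) b, - A (bs ! j) (u t) (u t) a] ! i"
      using null_frame_basis(2)[OF fr ij(1)] by (simp add: bs_def)
    also have "\<dots> = ((1 / t) \<cdot>\<^sub>m N t) $$ (i, j)"
      using ij by (auto simp: N_def Let_def ut eval_nat_numeral less_Suc_eq)
    finally show "op_matrix bs bs (jacobi_op g A (u t)) $$ (i, j) = ((1 / t) \<cdot>\<^sub>m N t) $$ (i, j)" .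
  qed
  have P: "P = char_poly ((1 / t) \<cdot>\<^sub>m N t)" if "t > 0" for t
  proof -
    have "P = op_char_poly (jacobi_op g A (u t))"
      unfolding P_def
      by (rule oss[unfolded osserman_def, rule_format]) (use u[of 1] u[OF that] in simp)
    then show ?thesis
      by (simp only: op_char_poly_eq[OF bs(1) linear_jacobi] mat[OF that])
  qed
  have N_carrier: "(1 / t) \<cdot>\<^sub>m N t \<in> carrier_mat 4 4" for t
    by (simp add: N_def)
  have P_deg: "degree P = 4" "coeff P 4 = 1"
    using degree_monic_char_poly[OF N_carrier, of 1] P[of 1] by simp_all
  have det_M: "det (M s t) = t ^ 4 * poly P (s / t)" if "t > 0" for s t
  proof -
    have "M s t = t \<cdot>\<^sub>m (- char_matrix ((1 / t) \<cdot>\<^sub>m N t) (s / t))"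
      using that by (intro eq_matI) (auto simp: M_def N_def char_matrix_def field_simps)
    moreover have "dim_col (- char_matrix ((1 / t) \<cdot>\<^sub>m N t) (s / t)) = 4"
      by (simp add: char_matrix_def N_def)
    ultimately show ?thesis
      using char_poly_matrix[OF N_carrier, of t "s / t"] P[OF that] by simp
  qed
  \<comment> \<open>\<open>P\<close> is one and the same monic quartic for all \<open>t > 0\<close>,
    so only its leading term survives the homogenisation in the limit.\<close>
  have lim_P: "((\<lambda>t. t ^ 4 * poly P (s / t)) \<longlongrightarrow> s ^ 4) (at_right 0)" for s
  proof -
    have "t ^ 4 * poly P (s / t) =
        s ^ 4 + coeff P 3 * s ^ 3 * t + coeff P 2 * s\<^sup>2 * t\<^sup>2 + coeff P 1 * s * t ^ 3 + coeff P 0 * t ^ 4"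
      if "t > 0" for t
      using that P_deg
      by (simp add: poly_altdef eval_nat_numeral divide_simps) (simp add: algebra_simps)
    then have "\<forall>\<^sub>F t in at_right 0. s ^ 4 + coeff P 3 * s ^ 3 * t + coeff P 2 * s\<^sup>2 * t\<^sup>2 +
        coeff P 1 * s * t ^ 3 + coeff P 0 * t ^ 4 = t ^ 4 * poly P (s / t)"
      by (intro eventually_at_right_less[THEN eventually_mono]) simp
    moreover have "((\<lambda>t. s ^ 4 + coeff P 3 * s ^ 3 * t + coeff P 2 * s\<^sup>2 * t\<^sup>2 +
        coeff P 1 * s * t ^ 3 + coeff P 0 * t ^ 4) \<longlongrightarrow> s ^ 4) (at_right 0)"
      by (auto intro!: tendsto_eq_intros)
    ultimately show ?thesis using tendsto_cong by fast
  qed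
  have lim_M: "((\<lambda>t. det (M s t)) \<longlongrightarrow> det (M s 0)) (at_right 0)" for s
  proof (rule tendsto_det[where n = 4])
    fix i j :: nat assume ij: "i < 4" "j < 4"
    have "((\<lambda>t. A y (x t) (x t) z) \<longlongrightarrow> A y (x 0) (x 0) z) (at_right 0)" for y z
      unfolding x_def A_simps by (auto intro!: tendsto_eq_intros)
    then have "((\<lambda>t. N t $$ (i, j)) \<longlongrightarrow> N 0 $$ (i, j)) (at_right 0)"
      using ij by (auto simp: N_def Let_def eval_nat_numeral less_Suc_eq intro!: tendsto_minus)
    then show "((\<lambda>t. M s t $$ (i, j)) \<longlongrightarrow> M s 0 $$ (i, j)) (at_right 0)"
      using ij by (auto simp: M_def intro!: tendsto_diff tendsto_minus)
  qed (simp_all add: M_def)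
  have "det (M s 0) = s ^ 4" for s
  proof (rule tendsto_unique[OF _ lim_M])
    show "((\<lambda>t. det (M s t)) \<longlongrightarrow> s ^ 4) (at_right 0)"
      by (rule Lim_transform_eventually[OF lim_P])
        (intro eventually_at_right_less[THEN eventually_mono], simp add: det_M)
  qed simp
  \<comment> \<open>The Jacobi operator of \<open>a\<close> kills \<open>a\<close> and takes values
    orthogonal to \<open>a\<close>. Column 0 and row 3 therefore contribute only \<open>s\<close>
    each, and the block on \<open>b, c\<close> remains; its diagonal entries agree because the
    operator is self-adjoint.\<close>
  moreover have "det (M s 0) = s\<^sup>2 * ((s - A b a a c)\<^sup>2 - A b a a b * A c a a c)" for s
  proof -
    have "A c a a b = A b a a c" 
      using A_pair[of c a a b] A_skew(1)[of a b c a] A_skew(2)[of b a c a] by simp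
    then show ?thesis
      by (subst det_4) (simp_all add: M_def N_def bs_def x_def eval_nat_numeral algebra_simps)
  qed
  ultimately have key: "s\<^sup>2 * ((s - A b a a c)\<^sup>2 - A b a a b * A c a a c) = s ^ 4" for s
    by simp
  \<comment> \<open>The difference of the two instances isolates \<open>A b a a c\<close>; either
    one then gives the product.\<close>
  have "A b a a c = 0 \<and> A b a a b * A c a a c = 0"
    using key[of 1] key[of "-1"] by (simp add: power2_eq_square algebra_simps)
  moreover have "A a b a c = - A b a a c" "A a b a b = - A b a a b" "A a c a c = - A c a a c"
    by (rule A_skew)+
  ultimately show "A a b a c = 0" "A a b a b * A a c a c = 0" by simp_all
qed

end

section \<open>Curvature tensors built from a para-quaternionic structure\<close>

lemma sum_pairs_3:
  "(\<Sum>(i, j) | 1 \<le> i \<and> i < j \<and> j \<le> (3::nat). F i j) = F 1 2 + F 1 3 + (F 2 3 :: real)"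
proof -
  have "{(i, j). 1 \<le> i \<and> i < j \<and> j \<le> (3::nat)} = {(1, 2), (1, 3), (2, 3)}"
    by auto
  then show ?thesis by simp
qed

lemma sum_1_3: "(\<Sum>i = 1..3::nat. F i) = F 1 + F 2 + (F 3 :: real)"
  by (simp add: eval_nat_numeral)

context signature22
begin

lemma skew_adjoint_orthogonal:
  assumes "skew_adjoint g \<Phi>"
  shows "g x (\<Phi> x) = 0"
proof -
  have "g (\<Phi> x) x = - g x (\<Phi> x)" using assms by (simp add: skew_adjoint_def)
  then show ?thesis using g_commute[of x "\<Phi> x"] by simp
qed

lemma skew_adjoint_anticommuting_orthogonal:
  assumes "skew_adjoint g \<Phi>" "skew_adjoint g \<Psi>" "\<Phi> (\<Psi> x) + \<Psi> (\<Phi> x) = 0"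
  shows "g (\<Phi> x) (\<Psi> x) = 0"
proof -
  have "g x (\<Phi> (\<Psi> x)) + g x (\<Psi> (\<Phi> x)) = g x 0"
    by (simp only: assms(3) flip: g_simps(1))
  moreover have "g (\<Phi> x) (\<Psi> x) = - g x (\<Phi> (\<Psi> x))" "g (\<Psi> x) (\<Phi> x) = - g x (\<Psi> (\<Phi> x))"
    using assms(1,2) unfolding skew_adjoint_def by blast+
  ultimately show ?thesis using g_commute[of "\<Phi> x" "\<Psi> x"] by simp
qed

text \<open>Skew-adjointness kills one term of \<open>RPhi_op\<close> and merges the other two. So
  the Jacobi operator has rank at most one and involves \<open>x\<close> only through
  \<open>\<Phi> x\<close>, a member of the basis constructed next.\<close>

lemma RPhi_jacobi:
  assumes "skew_adjoint g \<Phi>"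
  shows "RPhi g \<Phi> y x x z = 3 * g y (\<Phi> x) * g (\<Phi> x) z"
proof -
  have "g (\<Phi> x) x = 0" using skew_adjoint_orthogonal[OF assms, of x] by (simp only: g_commute)
  moreover have "g (\<Phi> y) x = - g y (\<Phi> x)" using assms by (simp add: skew_adjoint_def)
  ultimately show ?thesis by (simp add: curv_form_def RPhi_op_def)
qed

lemma skew_adjoint_diff:
  "skew_adjoint g \<Phi> \<Longrightarrow> skew_adjoint g \<Psi> \<Longrightarrow> skew_adjoint g (\<lambda>u. \<Phi> u - \<Psi> u)"
  by (simp add: skew_adjoint_def)

text \<open>As \<open>g (\<Phi> x) (\<Phi> x) = - g x (\<Phi> (\<Phi> x))\<close>, the squares fix
  the signs, and anticommutation gives orthogonality. The Gram matrix is thus the same for every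
  unit timelike \<open>x\<close>.\<close>

lemma para_quaternionic_basis:
  assumes x: "g x x = -1"
    and skew: "skew_adjoint g \<Phi>1" "skew_adjoint g \<Phi>2" "skew_adjoint g \<Phi>3"
    and sq: "\<And>x. \<Phi>1 (\<Phi>1 x) = - x" "\<And>x. \<Phi>2 (\<Phi>2 x) = x" "\<And>x. \<Phi>3 (\<Phi>3 x) = x"
    and anti: "\<And>x. \<Phi>1 (\<Phi>2 x) + \<Phi>2 (\<Phi>1 x) = 0" "\<And>x. \<Phi>1 (\<Phi>3 x) + \<Phi>3 (\<Phi>1 x) = 0"
      "\<And>x. \<Phi>2 (\<Phi>3 x) + \<Phi>3 (\<Phi>2 x) = 0"
  defines "bs \<equiv> [x, \<Phi>1 x, \<Phi>2 x, \<Phi>3 x]"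
  shows "i < 4 \<Longrightarrow> j < 4 \<Longrightarrow> g (bs ! i) (bs ! j) = (if i = j then if i < 2 then -1 else 1 else 0)"
    and "basis_list bs"
    and "i < 4 \<Longrightarrow> representation (set bs) w (bs ! i) = (if i < 2 then - g w (bs ! i) else g w (bs ! i))"
proof -
  have "g (\<Phi>1 x) (\<Phi>1 x) = -1" "g (\<Phi>2 x) (\<Phi>2 x) = 1" "g (\<Phi>3 x) (\<Phi>3 x) = 1"
    using skew sq x by (simp_all add: skew_adjoint_def)
  moreover have "g x (\<Phi>1 x) = 0" "g x (\<Phi>2 x) = 0" "g x (\<Phi>3 x) = 0"
    using skew by (simp_all add: skew_adjoint_orthogonal)
  moreover have "g (\<Phi>1 x) (\<Phi>2 x) = 0" "g (\<Phi>1 x) (\<Phi>3 x) = 0" "g (\<Phi>2 x) (\<Phi>3 x) = 0"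
    using skew anti by (auto intro: skew_adjoint_anticommuting_orthogonal)
  ultimately show gram: "g (bs ! i) (bs ! j) = (if i = j then if i < 2 then -1 else 1 else 0)"
    if "i < 4" "j < 4" for i j
    using x that unfolding bs_def
    by (auto simp: eval_nat_numeral less_Suc_eq g_commute[of "\<Phi>1 x" x] g_commute[of "\<Phi>2 x" x]
        g_commute[of "\<Phi>3 x" x] g_commute[of "\<Phi>2 x" "\<Phi>1 x"] g_commute[of "\<Phi>3 x" "\<Phi>1 x"]
        g_commute[of "\<Phi>3 x" "\<Phi>2 x"])
  define f where "f i w = (if i < 2 then - g w (bs ! i) else g w (bs ! i))" for i and w :: 'v
  have len: "length bs = 4" by (simp add: bs_def)
  have "linear (f i)" for i
    by (rule linearI) (simp_all add: f_def)
  moreover have "f i (bs ! j) = (if i = j then 1 else 0)" if "i < length bs" "j < length bs" for i j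
    using that gram[of j i] by (auto simp: f_def len)
  ultimately have "basis_list bs"
    "i < length bs \<Longrightarrow> representation (set bs) w (bs ! i) = f i w" for i w
    using basis_list_dual[of f bs] dim_UNIV len by auto
  then show "basis_list bs"
    "i < 4 \<Longrightarrow> representation (set bs) w (bs ! i) = (if i < 2 then - g w (bs ! i) else g w (bs ! i))"
    by (auto simp: f_def len)
qed

end

section \<open>The explicit form implies the Osserman property\<close>

context curvature22
begin

lemma osserman_if_para_quaternionic:
  fixes \<Phi> :: "nat \<Rightarrow> 'v \<Rightarrow> 'v"
  assumes A: "\<forall>x y z v. A x y z v =
          l0 * R0 g x y z v
          + (\<Sum>i=1..3. l i * RPhi g (\<Phi> i) x y z v)
          + (\<Sum>(i, j) | 1 \<le> i \<and> i < j \<and> j \<le> 3.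
               m i j * (RPhi g (\<Phi> i) x y z v + RPhi g (\<Phi> j) x y z v
                        - RPhi g (\<lambda>u. \<Phi> i u - \<Phi> j u) x y z v))"
    and sq: "\<forall>x. \<Phi> 1 (\<Phi> 1 x) = - x" "\<forall>x. \<Phi> 2 (\<Phi> 2 x) = x" "\<forall>x. \<Phi> 3 (\<Phi> 3 x) = x"
    and anti: "\<forall>i\<in>{1..3}. \<forall>j\<in>{1..3}. i \<noteq> j \<longrightarrow> (\<forall>x. \<Phi> i (\<Phi> j x) + \<Phi> j (\<Phi> i x) = 0)"
    and skew: "\<forall>i\<in>{1..3}. skew_adjoint g (\<Phi> i)"
  shows "osserman g A"
proof -
  have sk: "skew_adjoint g (\<Phi> 1)" "skew_adjoint g (\<Phi> 2)" "skew_adjoint g (\<Phi> 3)"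
    using skew by auto
  have ac: "\<Phi> 1 (\<Phi> 2 x) + \<Phi> 2 (\<Phi> 1 x) = 0" "\<Phi> 1 (\<Phi> 3 x) + \<Phi> 3 (\<Phi> 1 x) = 0"
      "\<Phi> 2 (\<Phi> 3 x) + \<Phi> 3 (\<Phi> 2 x) = 0" for x
    using anti by auto
  define bs where "bs x = [x, \<Phi> 1 x, \<Phi> 2 x, \<Phi> 3 x]" for x
  have len: "length (bs x) = 4" for x by (simp add: bs_def)
  have gram: "g (bs x ! i) (bs x ! j) = (if i = j then if i < 2 then -1 else 1 else 0)"
    if "g x x = -1" "i < 4" "j < 4" for x i j
    using para_quaternionic_basis(1)[of x "\<Phi> 1" "\<Phi> 2" "\<Phi> 3" i j] that sk sq ac by (simp add: bs_def)
  have basis: "basis_list (bs x)" if "g x x = -1" for x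
    using para_quaternionic_basis(2)[of x "\<Phi> 1" "\<Phi> 2" "\<Phi> 3"] that sk sq ac by (simp add: bs_def)
  have rep: "representation (set (bs x)) w (bs x ! i) = (if i < 2 then - g w (bs x ! i) else g w (bs x ! i))"
    if "g x x = -1" "i < 4" for x i w
    using para_quaternionic_basis(3)[of x "\<Phi> 1" "\<Phi> 2" "\<Phi> 3" i w] that sk sq ac by (simp add: bs_def)
  \<comment> \<open>Each bracket is a polarisation:
    \<open>p i * q i + p j * q j - (p i - p j) * (q i - q j)\<close> equals
    \<open>p i * q j + p j * q i\<close>. So the \<open>m i j\<close> are the off-diagonal and the
    \<open>l i\<close> the diagonal coefficients of a symmetric form.\<close>
  define Q where "Q p q = l 1 * (p 1 * q 1) + l 2 * (p 2 * q 2) + l 3 * (p 3 * q 3)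
      + m 1 2 * (p 1 * q 1 + p 2 * q 2 - (p 1 - p 2) * (q 1 - q 2))
      + m 1 3 * (p 1 * q 1 + p 3 * q 3 - (p 1 - p 3) * (q 1 - q 3))
      + m 2 3 * (p 2 * q 2 + p 3 * q 3 - (p 2 - p 3) * (q 2 - q 3))" for p q :: "nat \<Rightarrow> real"
  have jac: "A y x x z = l0 * (g y (bs x ! 0) * g (bs x ! 0) z - g x x * g y z)
      + 3 * Q (\<lambda>i. g y (bs x ! i)) (\<lambda>i. g (bs x ! i) z)" for x y z
  proof -
    have R: "R0 g y x x z = g y x * g x z - g x x * g y z"
      by (simp add: curv_form_def R0_op_def)
    have b: "bs x ! 0 = x" "bs x ! 1 = \<Phi> 1 x" "bs x ! 2 = \<Phi> 2 x" "bs x ! 3 = \<Phi> 3 x"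
      by (simp_all add: bs_def)
    show ?thesis
      unfolding A[rule_format] sum_pairs_3 sum_1_3 R RPhi_jacobi[OF sk(1)] RPhi_jacobi[OF sk(2)]
        RPhi_jacobi[OF sk(3)] RPhi_jacobi[OF skew_adjoint_diff[OF sk(1) sk(2)]]
        RPhi_jacobi[OF skew_adjoint_diff[OF sk(1) sk(3)]]
        RPhi_jacobi[OF skew_adjoint_diff[OF sk(2) sk(3)]] Q_def b
      by (simp add: algebra_simps)
  qed
  have mat: "op_matrix (bs x) (bs x) (jacobi_op g A x) = op_matrix (bs y) (bs y) (jacobi_op g A y)"
    if "g x x = -1" "g y y = -1" for x y
  proof (rule eq_matI; (simp add: op_matrix_def len; fail)?)
    fix i j assume "i < dim_row (op_matrix (bs y) (bs y) (jacobi_op g A y))"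
      "j < dim_col (op_matrix (bs y) (bs y) (jacobi_op g A y))"
    then have ij: "i < 4" "j < 4" by (simp_all add: op_matrix_def len)
    have "A (bs x ! j) x x (bs x ! i) = A (bs y ! j) y y (bs y ! i)"
      unfolding jac Q_def using that ij by (simp add: gram)
    then show "op_matrix (bs x) (bs x) (jacobi_op g A x) $$ (i, j) =
        op_matrix (bs y) (bs y) (jacobi_op g A y) $$ (i, j)"
      using ij that by (simp add: op_matrix_def len rep)
  qed
  show ?thesis
    unfolding osserman_def
  proof (intro allI impI; elim conjE)
    fix x y assume xy: "g x x = -1" "g y y = -1"
    show "op_char_poly (jacobi_op g A x) = op_char_poly (jacobi_op g A y)"
      unfolding op_char_poly_eq[OF basis[OF xy(1)] linear_jacobi[of x]]
        op_char_poly_eq[OF basis[OF xy(2)] linear_jacobi[of y]] mat[OF xy] ..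
  qed
qed

end

section \<open>Changes of null frame\<close>

text \<open>
  With \<open>a, b, c, d\<close> in the roles of \<open>e\<^sub>1 \<otimes> f\<^sub>1, e\<^sub>1 \<otimes> f\<^sub>2, e\<^sub>2 \<otimes> f\<^sub>1, e\<^sub>2 \<otimes> f\<^sub>2\<close>, \<open>tens\<close> is the decomposable
  vector \<open>u \<otimes> v\<close>, and \<open>biv\<close> is the value of \<open>F\<close> on the bivector \<open>(u \<otimes> f\<^sub>1) \<and> (u \<otimes> f\<^sub>2)\<close>.
  Swapping \<open>b\<close> and \<open>c\<close> exchanges the two factors.
\<close>

definition tens :: "'v::real_vector \<Rightarrow> 'v \<Rightarrow> 'v \<Rightarrow> 'v \<Rightarrow> real \<Rightarrow> real \<Rightarrow> real \<Rightarrow> real \<Rightarrow> 'v" where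
  "tens a b c d u1 u2 v1 v2 = (u1 * v1) *\<^sub>R a + (u1 * v2) *\<^sub>R b + (u2 * v1) *\<^sub>R c + (u2 * v2) *\<^sub>R d"

definition biv :: "'v \<Rightarrow> 'v \<Rightarrow> 'v \<Rightarrow> 'v \<Rightarrow> real \<Rightarrow> real \<Rightarrow> ('v::real_vector \<Rightarrow> 'v \<Rightarrow> real) \<Rightarrow> real" where
  "biv a b c d u1 u2 F = u1\<^sup>2 * F a b + u1 * u2 * (F a d + F c b) + u2\<^sup>2 * F c d"

lemma tens_swap: "tens a c b d v1 v2 u1 u2 = tens a b c d u1 u2 v1 v2"
  by (simp add: tens_def mult.commute)

lemma alternating_skew:
  assumes F: "bilinear F" "\<And>x. F x x = (0::real)"
  shows "F y x = - F x y"
proof -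
  have "F (x + y) (x + y) = F x x + F x y + (F y x + F y y)"
    by (simp only: bilinear_ladd[OF F(1)] bilinear_radd[OF F(1)] add.assoc)
  then show ?thesis unfolding F(2) by linarith
qed

text \<open>For fixed \<open>u\<close> both arguments lie in the span of
  \<open>u \<otimes> f\<^sub>1\<close> and \<open>u \<otimes> f\<^sub>2\<close>, where an
  alternating form is a determinant times its value on these two vectors.\<close>

lemma alternating_tens:
  assumes F: "bilinear F" "\<And>x. F x x = (0::real)"
  shows "F (tens a b c d u1 u2 v1 v2) (tens a b c d u1 u2 w1 w2) =
    (v1 * w2 - v2 * w1) * biv a b c d u1 u2 F"
proof -
  note skew = alternating_skew[OF F]
  show ?thesis
    unfolding tens_def biv_def
    by (simp add: bilinear_ladd[OF F(1)] bilinear_radd[OF F(1)] bilinear_lmul[OF F(1)]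
        bilinear_rmul[OF F(1)] F(2) skew[of a b] skew[of a c] skew[of a d] skew[of b c] skew[of b d]
        skew[of c d] algebra_simps power2_eq_square)
qed

context signature22
begin

lemma g_tens:
  assumes "null_frame g a b c d"
  shows "g (tens a b c d u1 u2 v1 v2) (tens a b c d w1 w2 z1 z2) = - (u1 * w2 - u2 * w1) * (v1 * z2 - v2 * z1)"
  by (simp add: tens_def null_frame_values[OF assms] algebra_simps)

lemma null_frame_tens:
  assumes "null_frame g a b c d" "u1 * w2 - u2 * w1 = 1" "v1 * z2 - v2 * z1 = 1"
  shows "null_frame g (tens a b c d u1 u2 v1 v2) (tens a b c d u1 u2 z1 z2)
    (tens a b c d w1 w2 v1 v2) (tens a b c d w1 w2 z1 z2)"
proof -
  have "w1 * u2 - w2 * u1 = -1" "z1 * v2 - z2 * v1 = -1"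
    using assms(2,3) by (simp_all add: mult.commute)
  then show ?thesis
    unfolding null_frame_def g_tens[OF assms(1)] assms(2,3) by (simp add: mult.commute)
qed

lemma null_frame_swap: "null_frame g a b c d \<Longrightarrow> null_frame g a c b d"
  by (simp add: null_frame_def g_commute)

lemma null_frame_expand:
  assumes "null_frame g a b c d"
  shows "x = (- g x d) *\<^sub>R a + g x c *\<^sub>R b + g x b *\<^sub>R c + (- g x a) *\<^sub>R d"
proof -
  let ?w = "x - ((- g x d) *\<^sub>R a + g x c *\<^sub>R b + g x b *\<^sub>R c + (- g x a) *\<^sub>R d)"
  have "g ?w y = 0" if "y \<in> {a, b, c, d}" for y
    using that by (auto simp: null_frame_values[OF assms])
  moreover have "y \<in> span {a, b, c, d}" for y
    using null_frame_basis(1)[OF assms] by (simp add: basis_list_def)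
  ultimately have "g ?w y = 0" for y
    using linear_eq_0_on_span[OF linear_g(1)] by blast
  then have "?w = 0" by (intro g_ext) (simp only: g_simps)
  then show ?thesis by (simp only: right_minus_eq)
qed

lemma alternating_zero:
  assumes fr: "null_frame g a b c d" and F: "bilinear F" "\<And>x. F x x = (0::real)"
    and "F a b = 0" "F a c = 0" "F a d = 0" "F b c = 0" "F b d = 0" "F c d = 0"
  shows "F x y = 0"
proof -
  note skew = alternating_skew[OF F]
  note fs = bilinear_ladd[OF F(1)] bilinear_radd[OF F(1)] bilinear_lmul[OF F(1)] bilinear_rmul[OF F(1)]
  obtain p q r s where x: "x = p *\<^sub>R a + q *\<^sub>R b + r *\<^sub>R c + s *\<^sub>R d"
    by (rule that[OF null_frame_expand[OF fr]])
  obtain p' q' r' s' where y: "y = p' *\<^sub>R a + q' *\<^sub>R b + r' *\<^sub>R c + s' *\<^sub>R d"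
    by (rule that[OF null_frame_expand[OF fr]])
  show ?thesis
    unfolding x y using assms(4-)
    by (simp add: fs F(2) skew[of a b] skew[of a c] skew[of a d] skew[of b c] skew[of b d] skew[of c d])
qed

end

section \<open>Linear combinations of curvature tensors and a test for zero\<close>

lemma algebraic_curvature_tensorD:
  assumes "algebraic_curvature_tensor D"
  shows "four_linear D" "D x y z v = - D y x z v" "D x y z v = - D x y v z" "D x y z v = D z v x y"
    "D x y z v + D y z x v + D z x y v = 0"
  using assms unfolding algebraic_curvature_tensor_def by blast+

lemma curvature_bilinear:
  assumes "algebraic_curvature_tensor D"
  shows "bilinear (\<lambda>x y. D x y z v)" "bilinear (\<lambda>z v. D x y z v)" "D x x z v = 0" "D x y z z = 0"
proof -
  show "bilinear (\<lambda>x y. D x y z v)" "bilinear (\<lambda>z v. D x y z v)"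
    using algebraic_curvature_tensorD(1)[OF assms] by (simp_all add: bilinear_def four_linear_def)
  show "D x x z v = 0" "D x y z z = 0"
    using algebraic_curvature_tensorD(2)[OF assms, of x x z v]
      algebraic_curvature_tensorD(3)[OF assms, of x y z z] by linarith+
qed

lemma curvature_add:
  assumes "algebraic_curvature_tensor D" "algebraic_curvature_tensor E"
  shows "algebraic_curvature_tensor (\<lambda>x y z v. D x y z v + E x y z v)"
proof -
  note D = algebraic_curvature_tensorD[OF assms(1)] and E = algebraic_curvature_tensorD[OF assms(2)]
  have "four_linear (\<lambda>x y z v. D x y z v + E x y z v)"
    using D(1) E(1) by (simp add: four_linear_def linear_compose_add)
  then show ?thesis
    unfolding algebraic_curvature_tensor_def
  proof (intro conjI allI)
    fix x y z v
    show "D x y z v + E x y z v = - (D y x z v + E y x z v)"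
      using D(2)[of x y z v] E(2)[of x y z v] by linarith
    show "D x y z v + E x y z v = - (D x y v z + E x y v z)"
      using D(3)[of x y z v] E(3)[of x y z v] by linarith
    show "D x y z v + E x y z v = D z v x y + E z v x y"
      using D(4)[of x y z v] E(4)[of x y z v] by linarith
    show "D x y z v + E x y z v + (D y z x v + E y z x v) + (D z x y v + E z x y v) = 0"
      using D(5)[of x y z v] E(5)[of x y z v] by linarith
  qed
qed

lemma curvature_scale:
  assumes "algebraic_curvature_tensor D"
  shows "algebraic_curvature_tensor (\<lambda>x y z v. r * D x y z v)"
proof -
  note D = algebraic_curvature_tensorD[OF assms]
  have "linear (\<lambda>x. r * f x)" if "linear f" for f :: "'a \<Rightarrow> real"
    using linear_compose_scale_right[OF that, of r] by simp
  then have "four_linear (\<lambda>x y z v. r * D x y z v)"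
    using D(1) by (simp add: four_linear_def)
  then show ?thesis
    unfolding algebraic_curvature_tensor_def
  proof (intro conjI allI)
    fix x y z v
    show "r * D x y z v = - (r * D y x z v)"
      by (subst D(2)) simp
    show "r * D x y z v = - (r * D x y v z)"
      by (subst D(3)) simp
    show "r * D x y z v = r * D z v x y"
      by (subst D(4)) simp
    show "r * D x y z v + r * D y z x v + r * D z x y v = 0"
      unfolding distrib_left[symmetric] D(5) by simp
  qed
qed

lemma curvature_diff:
  assumes "algebraic_curvature_tensor D" "algebraic_curvature_tensor E"
  shows "algebraic_curvature_tensor (\<lambda>x y z v. D x y z v - E x y z v)"
  using curvature_add[OF assms(1) curvature_scale[OF assms(2), of "-1"]] by simp

context signature22
begin

text \<open>Skew-adjointness makes \<open>g (\<Phi> x) y\<close> alternating in \<open>x, y\<close>;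
  the factor 2 in \<open>RPhi_op\<close> is what makes the cyclic sum vanish.\<close>

lemma curvature_RPhi:
  assumes lin: "linear \<Phi>" and skew: "skew_adjoint g \<Phi>"
  shows "algebraic_curvature_tensor (RPhi g \<Phi>)"
proof -
  have sk: "g (\<Phi> y) x = - g (\<Phi> x) y" for x y
  proof -
    have "g (\<Phi> y) x = - g y (\<Phi> x)" using skew unfolding skew_adjoint_def by blast
    then show ?thesis by (simp only: g_commute[of y])
  qed
  have eq: "RPhi g \<Phi> x y z v =
      g (\<Phi> y) z * g (\<Phi> x) v - g (\<Phi> x) z * g (\<Phi> y) v - 2 * g (\<Phi> x) y * g (\<Phi> z) v" for x y z v
    by (simp add: curv_form_def RPhi_op_def)
  have "four_linear (RPhi g \<Phi>)"
    unfolding four_linear_def eq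
    by (intro conjI allI linearI)
      (simp_all add: linear_add[OF lin] linear_scale[OF lin] algebra_simps)
  then show ?thesis
    unfolding algebraic_curvature_tensor_def
  proof (intro conjI allI)
    fix x y z v
    show "RPhi g \<Phi> x y z v = - RPhi g \<Phi> y x z v"
      unfolding eq by (simp add: sk[of y x])
    show "RPhi g \<Phi> x y z v = - RPhi g \<Phi> x y v z"
      unfolding eq by (simp add: sk[of v z])
    show "RPhi g \<Phi> x y z v = RPhi g \<Phi> z v x y"
      unfolding eq by (simp add: sk[of v x] sk[of z y] sk[of v y] sk[of z x])
    show "RPhi g \<Phi> x y z v + RPhi g \<Phi> y z x v + RPhi g \<Phi> z x y v = 0"
      unfolding eq by (simp add: sk[of z x] sk[of z y] sk[of y x] algebra_simps)
  qed
qed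

text \<open>A curvature tensor is a bilinear form on bivectors, so the pairs of frame bivectors
  decide.\<close>

lemma curvature_zero:
  assumes fr: "null_frame g a b c d" and D: "algebraic_curvature_tensor D"
    and zero: "\<forall>(p, q) \<in> {(a, b), (a, c), (a, d), (b, c), (b, d), (c, d)}.
      \<forall>(r, s) \<in> {(a, b), (a, c), (a, d), (b, c), (b, d), (c, d)}. D p q r s = 0"
  shows "D x y z v = 0"
proof -
  note cb = curvature_bilinear[OF D]
  have inner: "D p q z v = 0" if "D p q a b = 0" "D p q a c = 0" "D p q a d = 0"
      "D p q b c = 0" "D p q b d = 0" "D p q c d = 0" for p q
    by (rule alternating_zero[OF fr cb(2) cb(4)]) (fact that)+
  show ?thesis
    by (rule alternating_zero[OF fr cb(1) cb(3)]; rule inner) (use zero in simp_all)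
qed

end

section \<open>The Osserman condition on decomposable null bivectors\<close>

context curvature22
begin

lemma bilinear_biv: "bilinear (\<lambda>p q. biv a b c d u1 u2 (\<lambda>r s. A r s p q))"
  and biv_diag: "biv a b c d u1 u2 (\<lambda>r s. A r s p p) = 0"
  unfolding biv_def bilinear_def by (auto intro!: linearI simp: algebra_simps)

text \<open>The two frames may differ: below, one of them often has \<open>b\<close> and
  \<open>c\<close> swapped, so that its common factor lies in the other plane.\<close>

lemma A_tens:
  "A (tens a b c d u1 u2 v1 v2) (tens a b c d u1 u2 z1 z2)
     (tens a' b' c' d' u1' u2' v1' v2') (tens a' b' c' d' u1' u2' z1' z2') =
   (v1 * z2 - v2 * z1) * (v1' * z2' - v2' * z1') *
     biv a' b' c' d' u1' u2' (\<lambda>p q. biv a b c d u1 u2 (\<lambda>r s. A r s p q))"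
proof -
  have "A (tens a b c d u1 u2 v1 v2) (tens a b c d u1 u2 z1 z2) p q =
      (v1 * z2 - v2 * z1) * biv a b c d u1 u2 (\<lambda>r s. A r s p q)" for p q
    by (rule alternating_tens) (use curvature_bilinear[OF curvature] in auto)
  moreover note alternating_tens[OF bilinear_biv biv_diag, of a b c d u1 u2 a' b' c' d' u1' u2' v1' v2' z1' z2']
  ultimately show ?thesis by simp
qed

text \<open>This is \<open>osserman_null_frame\<close> for the frames starting with
  \<open>u \<otimes> v\<close>. The mixed value \<open>C\<close> of \<open>B\<close> is a trace-free
  Ricci component, and the two factors of the product are the quartics of the two halves of the Weyl
  tensor.\<close>

lemma osserman_bivectors:
  assumes oss: "osserman g A" and fr: "null_frame g a b c d"
    and u: "(u1, u2) \<noteq> (0, 0)" and v: "(v1, v2) \<noteq> (0, 0)"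
  defines "B \<equiv> biv a b c d u1 u2" and "C \<equiv> biv a c b d v1 v2"
  shows "C (\<lambda>p q. B (\<lambda>r s. A r s p q)) = 0"
    and "B (\<lambda>p q. B (\<lambda>r s. A r s p q)) * C (\<lambda>p q. C (\<lambda>r s. A r s p q)) = 0"
proof -
  define n k where "n = u1\<^sup>2 + u2\<^sup>2" and "k = v1\<^sup>2 + v2\<^sup>2"
  have nz: "n \<noteq> 0" "k \<noteq> 0"
    using u v by (auto simp: n_def k_def sum_power2_eq_zero_iff)
  \<comment> \<open>A quarter turn of \<open>u\<close> and of \<open>v\<close>, divided by the
    squared length, completes each to a unimodular basis.\<close>
  define w1 w2 z1 z2 where "w1 = - u2 / n" and "w2 = u1 / n" and "z1 = - v2 / k" and "z2 = v1 / k"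
  have det: "u1 * w2 - u2 * w1 = 1" "v1 * z2 - v2 * z1 = 1"
    using nz by (simp_all add: w1_def w2_def z1_def z2_def n_def k_def divide_simps power2_eq_square)
  note fr' = null_frame_tens[OF fr det]
  \<comment> \<open>\<open>u \<otimes> v\<close> and \<open>w \<otimes> v\<close> share their second
    factor, so this pair is rewritten in the swapped frame, where \<open>A_tens\<close>
    applies.\<close>
  have "A (tens a b c d u1 u2 v1 v2) (tens a b c d u1 u2 z1 z2)
      (tens a c b d v1 v2 u1 u2) (tens a c b d v1 v2 w1 w2) = 0"
    using osserman_null_frame(1)[OF oss fr'] by (simp only: tens_swap[of a c b d])
  then show "C (\<lambda>p q. B (\<lambda>r s. A r s p q)) = 0"
    unfolding A_tens det B_def C_def by simp
  have "A (tens a b c d u1 u2 v1 v2) (tens a b c d u1 u2 z1 z2)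
      (tens a b c d u1 u2 v1 v2) (tens a b c d u1 u2 z1 z2) *
    A (tens a c b d v1 v2 u1 u2) (tens a c b d v1 v2 w1 w2)
      (tens a c b d v1 v2 u1 u2) (tens a c b d v1 v2 w1 w2) = 0"
    using osserman_null_frame(2)[OF oss fr'] by (simp only: tens_swap[of a c b d])
  then show "B (\<lambda>p q. B (\<lambda>r s. A r s p q)) * C (\<lambda>p q. C (\<lambda>r s. A r s p q)) = 0"
    unfolding A_tens det B_def C_def by simp
qed

text \<open>If one quartic is nonzero at a single point, the product condition makes the other
  vanish everywhere; swapping \<open>b\<close> and \<open>c\<close> then exchanges their
  roles.\<close>

lemma osserman_half_flat:
  assumes oss: "osserman g A"
  obtains a b c d where "null_frame g a b c d"
    "\<forall>v1 v2. (v1, v2) \<noteq> (0, 0) \<longrightarrow>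
      biv a c b d v1 v2 (\<lambda>p q. biv a c b d v1 v2 (\<lambda>r s. A r s p q)) = 0"
proof -
  obtain a b c d where fr: "null_frame g a b c d"
    using null_frame_exists by blast
  show ?thesis
  proof (cases "\<forall>v1 v2. (v1, v2) \<noteq> (0, 0) \<longrightarrow>
      biv a c b d v1 v2 (\<lambda>p q. biv a c b d v1 v2 (\<lambda>r s. A r s p q)) = 0")
    case True
    with that[OF fr] show ?thesis by blast
  next
    case False
    then obtain v1 v2 where v: "(v1, v2) \<noteq> (0, 0)"
      "biv a c b d v1 v2 (\<lambda>p q. biv a c b d v1 v2 (\<lambda>r s. A r s p q)) \<noteq> 0"
      by blast
    have "biv a b c d u1 u2 (\<lambda>p q. biv a b c d u1 u2 (\<lambda>r s. A r s p q)) = 0" if "(u1, u2) \<noteq> (0, 0)" for u1 u2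
      using osserman_bivectors(2)[OF oss fr that v(1)] v(2) by (simp only: mult_eq_0_iff simp_thms)
    then show ?thesis using that[OF null_frame_swap[OF fr]] by blast
  qed
qed

end

section \<open>The components of an Osserman curvature tensor\<close>

context curvature22
begin

text \<open>The conditions are polynomial identities in \<open>u\<close> and \<open>v\<close>, so a
  few sample points extract their coefficients. With the Bianchi identity, only
  \<open>A a b a b\<close>, \<open>A a b a d\<close>, \<open>A a b c d\<close>,
  \<open>A a d a d\<close>, \<open>A a d c d\<close> and \<open>A c d c d\<close> stay free.\<close>

lemma osserman_components:
  assumes oss: "osserman g A" and fr: "null_frame g a b c d"
    and flat: "\<forall>v1 v2. (v1, v2) \<noteq> (0, 0) \<longrightarrow>
      biv a c b d v1 v2 (\<lambda>p q. biv a c b d v1 v2 (\<lambda>r s. A r s p q)) = 0"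
  shows "A a b a c = 0" "A a b b c = - A a b a d" "A a b b d = 0"
    "A a c a d = 0" "A a c b c = 0" "A b c b c = A a d a d" "A a d b d = 0" "A b c b d = 0"
    "A a c c d = 0" "A b c c d = - A a d c d" "A b d c d = 0"
    "A a c a c = 0" "A b d b d = 0"
    "A a d b c = - (A a d a d + A a b c d) / 2" "A a c b d = (A a b c d - A a d a d) / 2"
proof -
  \<comment> \<open>Oriented symmetries: the pair \<open>c b\<close> is reversed and the two
    bivectors are ordered, so equal components become the same term.\<close>
  note norm = A_skew(1)[of c b] A_skew(2)[of _ _ c b] A_pair[of a d a b] A_pair[of b c a b] A_pair[of c d a b]
    A_pair[of a c a b] A_pair[of b d a b] A_pair[of a d a c] A_pair[of b c a c] A_pair[of b d a c] A_pair[of c d a c]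
    A_pair[of b c a d] A_pair[of b d a d] A_pair[of c d a d] A_pair[of b d b c] A_pair[of c d b c] A_pair[of c d b d]
  note E = osserman_bivectors(1)[OF oss fr, unfolded biv_def]
  note F = flat[rule_format, unfolded biv_def]
  have e: "A a b a c = 0" "A a b b d = 0" "A a c c d = 0" "A b d c d = 0"
    using E[of 1 0 1 0] E[of 1 0 0 1] E[of 0 1 1 0] E[of 0 1 0 1] by (simp_all add: norm)
  have f: "A a c a c = 0" "A b d b d = 0"
    using F[of 1 0] F[of 0 1] by (simp_all add: norm)
  have "A a b a d + A a b b c = 0" "A a d c d + A b c c d = 0" "A a c a d - A a c b c = 0" "A a d b d - A b c b d = 0"
    using E[of 1 0 1 1] E[of 0 1 1 1] E[of 1 1 1 0] E[of 1 1 0 1] e by (simp_all add: norm algebra_simps)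
  moreover have "A a d a d - A b c b c = 0"
    using E[of 1 1 1 1] E[of 1 0 1 1] E[of 0 1 1 1] E[of 1 1 1 0] E[of 1 1 0 1] e
    by (simp add: norm algebra_simps)
  \<comment> \<open>Inner coefficients of the quartic; \<open>w\<close> is that of
    \<open>v1\<^sup>2 * v2\<^sup>2\<close>. The first two sums, together with the differences
    obtained before, make each component vanish separately.\<close>
  moreover have "A a c a d + A a c b c = 0" "A a d b d + A b c b d = 0"
    and w: "2 * A a c b d + A a d a d + 2 * A a d b c + A b c b c = 0"
    using F[of 1 1] F[of 1 "-1"] F[of 1 2] f by (simp_all add: norm algebra_simps)
  moreover have bianchi: "A a c b d = A a b c d + A a d b c"
    using A_bianchi[of a b c d] A_skew(1)[of c a b d] by (simp add: norm)
  ultimately show "A a b a c = 0" "A a b b c = - A a b a d" "A a b b d = 0"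
    "A a c a d = 0" "A a c b c = 0" and r: "A b c b c = A a d a d" and "A a d b d = 0" "A b c b d = 0"
    "A a c c d = 0" "A b c c d = - A a d c d" "A b d c d = 0"
    "A a c a c = 0" "A b d b d = 0"
    using e f by linarith+
  have "2 * (A a b c d + A a d b c) + 2 * A a d a d + 2 * A a d b c = 0"
    using w unfolding r bianchi by simp
  then show "A a d b c = - (A a d a d + A a b c d) / 2" by simp
  with bianchi show "A a c b d = (A a b c d - A a d a d) / 2" by (simp add: field_simps)
qed

section \<open>The para-quaternionic structure of an Osserman curvature tensor\<close>

lemma para_quaternionic_if_osserman:
  assumes oss: "osserman g A"
  shows "\<exists>(\<Phi> :: nat \<Rightarrow> 'v \<Rightarrow> 'v) (l0 :: real) (l :: nat \<Rightarrow> real) (m :: nat \<Rightarrow> nat \<Rightarrow> real).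
       (\<forall>i\<in>{1..3}. linear (\<Phi> i) \<and> skew_adjoint g (\<Phi> i)) \<and>
       \<Phi> 3 = \<Phi> 2 \<circ> \<Phi> 1 \<and>
       (\<forall>x. \<Phi> 1 (\<Phi> 1 x) = - x) \<and> (\<forall>x. \<Phi> 2 (\<Phi> 2 x) = x) \<and> (\<forall>x. \<Phi> 3 (\<Phi> 3 x) = x) \<and>
       (\<forall>i\<in>{1..3}. \<forall>j\<in>{1..3}. i \<noteq> j \<longrightarrow> (\<forall>x. \<Phi> i (\<Phi> j x) + \<Phi> j (\<Phi> i x) = 0)) \<and>
       (\<forall>x y z v. A x y z v =
          l0 * R0 g x y z v
          + (\<Sum>i=1..3. l i * RPhi g (\<Phi> i) x y z v)
          + (\<Sum>(i, j) | 1 \<le> i \<and> i < j \<and> j \<le> 3.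
               m i j * (RPhi g (\<Phi> i) x y z v + RPhi g (\<Phi> j) x y z v
                        - RPhi g (\<lambda>u. \<Phi> i u - \<Phi> j u) x y z v)))"
proof -
  obtain a b c d where fr: "null_frame g a b c d"
    and flat: "\<forall>v1 v2. (v1, v2) \<noteq> (0, 0) \<longrightarrow>
      biv a c b d v1 v2 (\<lambda>p q. biv a c b d v1 v2 (\<lambda>r s. A r s p q)) = 0"
    using osserman_half_flat[OF oss] by blast
  note comps = osserman_components[OF oss fr flat]
  note frs = null_frame_values[OF fr]
  txt \<open>
    \<open>P1\<close> and \<open>P2\<close> act on the first tensor factor by \<open>e\<^sub>1 \<mapsto> e\<^sub>2, e\<^sub>2 \<mapsto> -e\<^sub>1\<close> and by
    \<open>e\<^sub>1 \<mapsto> e\<^sub>2, e\<^sub>2 \<mapsto> e\<^sub>1\<close>.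
  \<close>
  define P1 where "P1 x = g x d *\<^sub>R (- c) + g x c *\<^sub>R d - g x b *\<^sub>R a + g x a *\<^sub>R b" for x
  define P2 where "P2 x = g x d *\<^sub>R (- c) + g x c *\<^sub>R d + g x b *\<^sub>R a - g x a *\<^sub>R b" for x
  define P3 where "P3 = P2 \<circ> P1"
  have P: "P1 a = c" "P1 b = d" "P1 c = - a" "P1 d = - b"
    "P2 a = c" "P2 b = d" "P2 c = a" "P2 d = b"
    by (simp_all add: P1_def P2_def frs)
  have lin1: "linear P1" and lin2: "linear P2"
    by (rule linearI; simp add: P1_def P2_def algebra_simps)+
  then have lin3: "linear P3" unfolding P3_def by (rule linear_compose)
  note lins = lin1 lin2 lin3
  note P_simps = lins[THEN linear_add] lins[THEN linear_diff] lins[THEN linear_neg] lins[THEN linear_scale]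
  have P3: "P3 a = a" "P3 b = b" "P3 c = - c" "P3 d = - d"
    by (simp_all add: P3_def P P_simps)
  have ext: "\<phi> x = \<psi> x" if "linear \<phi>" "linear \<psi>" "\<phi> a = \<psi> a" "\<phi> b = \<psi> b" "\<phi> c = \<psi> c" "\<phi> d = \<psi> d"
    for \<phi> \<psi> :: "'v \<Rightarrow> 'v" and x
  proof (rule linear_eq_on_span[OF that(1,2)])
    show "x \<in> span {a, b, c, d}"
      using null_frame_basis(1)[OF fr] by (simp add: basis_list_def)
  qed (use that in auto)
  have comp: "linear (\<lambda>x. \<phi> (\<psi> x))" if "linear \<phi>" "linear \<psi>" for \<phi> \<psi> :: "'v \<Rightarrow> 'v"
    using linear_compose[OF that(2,1)] by (simp add: o_def)
  have sq: "P1 (P1 x) = - x" "P2 (P2 x) = x" "P3 (P3 x) = x" for x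
    using ext[OF comp[OF lin1 lin1] linear_uminus, of x] ext[OF comp[OF lin2 lin2] linear_ident, of x]
      ext[OF comp[OF lin3 lin3] linear_ident, of x]
    by (simp_all add: P P3 P_simps)
  have anti: "P1 (P2 x) + P2 (P1 x) = 0" "P1 (P3 x) + P3 (P1 x) = 0" "P2 (P3 x) + P3 (P2 x) = 0" for x
    using ext[OF linear_compose_add[OF comp[OF lin1 lin2] comp[OF lin2 lin1]] linear_zero, of x]
      ext[OF linear_compose_add[OF comp[OF lin1 lin3] comp[OF lin3 lin1]] linear_zero, of x]
      ext[OF linear_compose_add[OF comp[OF lin2 lin3] comp[OF lin3 lin2]] linear_zero, of x]
    by (simp_all add: P P3 P_simps)
  \<comment> \<open>Trace-free maps of the first plane are skew for its area form, hence for
    \<open>g\<close>.\<close>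
  have "g (P1 x) y = - g x (P1 y)" "g (P2 x) y = - g x (P2 y)" for x y
    unfolding P1_def P2_def
    by (simp_all add: g_commute[of a y] g_commute[of b y] g_commute[of c y] g_commute[of d y] algebra_simps)
  then have skew: "skew_adjoint g P1" "skew_adjoint g P2"
    by (simp_all add: skew_adjoint_def)
  have "g (P3 x) y = - g x (P3 y)" for x y
  proof -
    have "P2 (P1 y) = - P1 (P2 y)" using anti(1)[of y] by (simp only: add_eq_0_iff)
    then show ?thesis using skew by (simp add: P3_def skew_adjoint_def)
  qed
  then have skew3: "skew_adjoint g P3" by (simp add: skew_adjoint_def)
  define \<Phi> :: "nat \<Rightarrow> 'v \<Rightarrow> 'v" where "\<Phi> i = (if i = 1 then P1 else if i = 2 then P2 else P3)" for i
  have \<Phi>: "\<Phi> 1 = P1" "\<Phi> (Suc 0) = P1" "\<Phi> 2 = P2" "\<Phi> 3 = P3"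
    by (simp_all add: \<Phi>_def)
  txt \<open>These constants solve the linear system given by the components in the frame.\<close>
  define l3 where "l3 = - A a d a d / 3"
  define s where "s = - (A a b a b + A c d c d) / 6"
  define t where "t = (A a b c d + l3) / 2"
  \<comment> \<open>Here \<open>s\<close> is \<open>l 1 + l 2\<close> and \<open>t\<close> is
    \<open>l 2 - l 1\<close>. Index 0 of the list is padding, and \<open>m\<close> is read only at
    \<open>i < j\<close>, so \<open>j = 2\<close> means the pair (1, 2).\<close>
  define l :: "nat \<Rightarrow> real" where "l i = [0, (s - t) / 2, (s + t) / 2, l3] ! i" for i
  define m :: "nat \<Rightarrow> nat \<Rightarrow> real" where "m i j = (if j = 2 then (A c d c d - A a b a b) / 12
      else if i = 1 then (A a b a d + A a d c d) / 6 else (A a b a d - A a d c d) / 6)" for i j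
  \<comment> \<open>The desired expression with its sums written out, so that the closure lemmas for
    curvature tensors apply.\<close>
  define T where "T x y z v = l 1 * RPhi g P1 x y z v + l 2 * RPhi g P2 x y z v + l 3 * RPhi g P3 x y z v
      + (m 1 2 * (RPhi g P1 x y z v + RPhi g P2 x y z v - RPhi g (\<lambda>u. P1 u - P2 u) x y z v)
      + m 1 3 * (RPhi g P1 x y z v + RPhi g P3 x y z v - RPhi g (\<lambda>u. P1 u - P3 u) x y z v)
      + m 2 3 * (RPhi g P2 x y z v + RPhi g P3 x y z v - RPhi g (\<lambda>u. P2 u - P3 u) x y z v))" for x y z v
  have R: "algebraic_curvature_tensor (RPhi g P1)" "algebraic_curvature_tensor (RPhi g P2)"
      "algebraic_curvature_tensor (RPhi g P3)" "algebraic_curvature_tensor (RPhi g (\<lambda>u. P1 u - P2 u))"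
      "algebraic_curvature_tensor (RPhi g (\<lambda>u. P1 u - P3 u))"
      "algebraic_curvature_tensor (RPhi g (\<lambda>u. P2 u - P3 u))"
    by (intro curvature_RPhi linear_compose_sub lins skew skew3 skew_adjoint_diff)+
  have T: "algebraic_curvature_tensor T"
    unfolding T_def[abs_def] by (intro curvature_add curvature_diff curvature_scale R)
  have "A x y z v - T x y z v = 0" for x y z v
  proof (rule curvature_zero[OF fr curvature_diff[OF curvature T]])
    note norm = A_pair[of a d a b] A_pair[of b c a b] A_pair[of c d a b]
      A_pair[of a c a b] A_pair[of b d a b] A_pair[of a d a c] A_pair[of b c a c] A_pair[of b d a c] A_pair[of c d a c]
      A_pair[of b c a d] A_pair[of b d a d] A_pair[of c d a d] A_pair[of b d b c] A_pair[of c d b c] A_pair[of c d b d]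
    have ms: "m 1 2 = (A c d c d - A a b a b) / 12" "m 1 3 = (A a b a d + A a d c d) / 6"
      "m 2 3 = (A a b a d - A a d c d) / 6" "l 1 = (s - t) / 2" "l 2 = (s + t) / 2" "l 3 = l3"
      by (simp_all add: m_def l_def eval_nat_numeral)
    show "\<forall>(p, q) \<in> {(a, b), (a, c), (a, d), (b, c), (b, d), (c, d)}.
      \<forall>(r, s) \<in> {(a, b), (a, c), (a, d), (b, c), (b, d), (c, d)}. A p q r s - T p q r s = 0"
      unfolding T_def ms
      by (simp add: curv_form_def RPhi_op_def P P3 frs norm comps)
        (simp add: s_def t_def l3_def field_simps)
  qed
  then have A: "A x y z v = T x y z v" for x y z v by simp
  show ?thesis
  proof (intro exI[of _ \<Phi>] exI[of _ 0] exI[of _ l] exI[of _ m] conjI)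
    have "{1..3::nat} = {1, 2, 3}" by auto
    then show "\<forall>i\<in>{1..3}. linear (\<Phi> i) \<and> skew_adjoint g (\<Phi> i)"
      "\<forall>i\<in>{1..3}. \<forall>j\<in>{1..3}. i \<noteq> j \<longrightarrow> (\<forall>x. \<Phi> i (\<Phi> j x) + \<Phi> j (\<Phi> i x) = 0)"
      using lins skew skew3 anti by (simp_all add: \<Phi> add.commute)
    show "\<Phi> 3 = \<Phi> 2 \<circ> \<Phi> 1" by (simp only: \<Phi> P3_def)
    show "\<forall>x. \<Phi> 1 (\<Phi> 1 x) = - x" "\<forall>x. \<Phi> 2 (\<Phi> 2 x) = x" "\<forall>x. \<Phi> 3 (\<Phi> 3 x) = x"
      unfolding \<Phi> using sq by blast+
    show "\<forall>x y z v. A x y z v =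
          0 * R0 g x y z v
          + (\<Sum>i=1..3. l i * RPhi g (\<Phi> i) x y z v)
          + (\<Sum>(i, j) | 1 \<le> i \<and> i < j \<and> j \<le> 3.
               m i j * (RPhi g (\<Phi> i) x y z v + RPhi g (\<Phi> j) x y z v
                        - RPhi g (\<lambda>u. \<Phi> i u - \<Phi> j u) x y z v))"
      unfolding sum_pairs_3 sum_1_3 \<Phi> A T_def by simp
  qed
qed

end

theorem proposition1p2:
  fixes g :: "'v::real_vector \<Rightarrow> 'v \<Rightarrow> real"
    and A :: "'v \<Rightarrow> 'v \<Rightarrow> 'v \<Rightarrow> 'v \<Rightarrow> real"
  assumes "inner_product g" and "has_signature g 2 2"
    and "algebraic_curvature_tensor A"
  shows "osserman g A \<longleftrightarrow>
    (\<exists>(\<Phi> :: nat \<Rightarrow> 'v \<Rightarrow> 'v) (l0 :: real) (l :: nat \<Rightarrow> real) (m :: nat \<Rightarrow> nat \<Rightarrow> real).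
       (\<forall>i\<in>{1..3}. linear (\<Phi> i) \<and> skew_adjoint g (\<Phi> i)) \<and>
       \<Phi> 3 = \<Phi> 2 \<circ> \<Phi> 1 \<and>
       (\<forall>x. \<Phi> 1 (\<Phi> 1 x) = - x) \<and> (\<forall>x. \<Phi> 2 (\<Phi> 2 x) = x) \<and> (\<forall>x. \<Phi> 3 (\<Phi> 3 x) = x) \<and>
       (\<forall>i\<in>{1..3}. \<forall>j\<in>{1..3}. i \<noteq> j \<longrightarrow> (\<forall>x. \<Phi> i (\<Phi> j x) + \<Phi> j (\<Phi> i x) = 0)) \<and>
       (\<forall>x y z v. A x y z v =
          l0 * R0 g x y z v
          + (\<Sum>i=1..3. l i * RPhi g (\<Phi> i) x y z v)
          + (\<Sum>(i, j) | 1 \<le> i \<and> i < j \<and> j \<le> 3.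
               m i j * (RPhi g (\<Phi> i) x y z v + RPhi g (\<Phi> j) x y z v
                        - RPhi g (\<lambda>u. \<Phi> i u - \<Phi> j u) x y z v))))"
proof -
  interpret curvature22 g A
    by unfold_locales (rule assms)+
  show ?thesis
    by (rule iffI[OF para_quaternionic_if_osserman], assumption, elim exE conjE,
        rule osserman_if_para_quaternionic, assumption+, blast)
qed

end
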